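(* Let $K\ge1$ and $L>2K$. Let $h_\ell=\sum_{k=0}^{K-1}\eta_k\beta_k^\ell$, $\ell=0,\dots,L-1$, with non-zero coefficients $\eta_k\in\mathbb{C}$ and pairwise distinct non-zero bases $\beta_k\in\mathbb{C}$, let $e_0,\dots,e_{L-1}\in\mathbb{C}$, and let $E:=(e_{\ell+k})_{\ell,k=0}^{L-K-1,K}$ and $\tilde H:=(h_{\ell+k}+e_{\ell+k})_{\ell,k=0}^{L-K-1,K}$. Let $\tilde\gamma=(\tilde\gamma_k)_{k=0}^K$ be a normalized right singular vector to the smallest singular value $\tilde\sigma_K$ of $\tilde H$. Then the polynomial $\tilde P(z)=\sum_{k=0}^K\tilde\gamma_kz^k$ satisfies $$\sum_{k=0}^{K-1}|\eta_k|^2|\tilde P(\beta_k)|^2\le L\,\Bigl(\frac{\pi_\beta}{\sigma_\beta^{K-1}}\Bigr)^2\bigl(\tilde\sigma_K+\|E\|_2\bigr)^2.$$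
   Context: $\|E\|_2$ is the spectral norm; "normalized" means Euclidean norm one; the $(L-K)\times(K+1)$ matrix $\tilde H$ has $K+1$ singular values (counted with multiplicity). $\beta=(\beta_k)_{k=0}^{K-1}$, $\pi_\beta:=\prod_{k=0}^{K-1}(1+|\beta_k|)$, and $\sigma_\beta:=\min\{|\beta_\ell-\beta_k|:0\le\ell<k\le K-1\}$, where for $K=1$ the factor $\sigma_\beta^{K-1}$ is read as $1$. *)

theory Defs
  imports
    "HOL-Computational_Algebra.Computational_Algebra"
    "Jordan_Normal_Form.Schur_Decomposition"
begin

definition vec_norm2 :: "complex vec \<Rightarrow> real" where
  "vec_norm2 v = sqrt (\<Sum>i<dim_vec v. (cmod (v $ i))\<^sup>2)"

text \<open>The spectral norm is the operator norm induced by the Euclidean norms.\<close>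

definition spectral_norm :: "complex mat \<Rightarrow> real" where
  "spectral_norm A =
     Sup {vec_norm2 (A *\<^sub>v v) | v. v \<in> carrier_vec (dim_col A) \<and> vec_norm2 v = 1}"

text \<open>
  The singular values are the square roots of the eigenvalues of the Gram matrix, with algebraic
  multiplicity, so there is one for each column; \<^const>\<open>Re\<close> only serves to pass to the type of
  real numbers, as all these eigenvalues are real and non-negative.
\<close>

definition singular_values :: "complex mat \<Rightarrow> real multiset" where
  "singular_values A =
     image_mset (\<lambda>x. sqrt (Re x)) (proots (char_poly (mat_adjoint A * A)))"

lemma size_singular_values: "size (singular_values A) = dim_col A"
proof -
  have "mat_adjoint A * A \<in> carrier_mat (dim_col A) (dim_col A)"
    by (auto simp: mat_adjoint_def)
  then show ?thesis
    by (simp add: singular_values_def size_proots_complex degree_monic_char_poly)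
qed

definition smallest_singular_value :: "complex mat \<Rightarrow> real" where
  "smallest_singular_value A = Min (set_mset (singular_values A))"

definition right_singular_vector :: "complex mat \<Rightarrow> real \<Rightarrow> complex vec \<Rightarrow> bool" where
  "right_singular_vector A s v \<longleftrightarrow>
     s \<in># singular_values A \<and> eigenvector (mat_adjoint A * A) v (complex_of_real (s\<^sup>2))"

definition hankel_mat :: "nat \<Rightarrow> nat \<Rightarrow> (nat \<Rightarrow> complex) \<Rightarrow> complex mat" where
  "hankel_mat m n f = mat m n (\<lambda>(i, j). f (i + j))"

definition pi_bases :: "nat \<Rightarrow> (nat \<Rightarrow> complex) \<Rightarrow> real" where
  "pi_bases K \<beta> = (\<Prod>k<K. 1 + cmod (\<beta> k))"

text \<open>
  For \<open>K = 1\<close> this is the unspecified minimum of the empty set. It is only used as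
  \<open>sigma_bases K \<beta> ^ (K - 1)\<close>, which is then \<open>1\<close>.
\<close>

definition sigma_bases :: "nat \<Rightarrow> (nat \<Rightarrow> complex) \<Rightarrow> real" where
  "sigma_bases K \<beta> = Min {cmod (\<beta> l - \<beta> k) | l k. l < k \<and> k < K}"

end

theory Submission
  imports Defs "HOL-Analysis.L2_Norm"
begin

text \<open>
  Put \<open>c\<^sub>j = \<eta>\<^sub>j P(\<beta>\<^sub>j)\<close>. The unperturbed Hankel matrix maps \<open>\<gamma>\<close> to
  \<open>y\<^sub>l = \<Sum>\<^sub>j c\<^sub>j \<beta>\<^sub>j\<^sup>l\<close>, and \<open>y = H \<gamma> - E \<gamma>\<close> has norm at most \<open>\<sigma> + \<parallel>E\<parallel>\<close>.
  Pairing the first \<open>K\<close> entries of \<open>y\<close> with the coefficients of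
  \<open>\<Prod>\<^sub>k\<^sub>\<noteq>\<^sub>j (z - \<beta>\<^sub>k)\<close>, whose absolute values add up to at most \<open>\<pi>\<^sub>\<beta>\<close>, isolates
  \<open>c\<^sub>j \<Prod>\<^sub>k\<^sub>\<noteq>\<^sub>j (\<beta>\<^sub>j - \<beta>\<^sub>k)\<close>. Hence \<open>|c\<^sub>j| \<sigma>\<^sub>\<beta>\<^sup>K\<^sup>-\<^sup>1 \<le> \<pi>\<^sub>\<beta> \<parallel>y\<parallel>\<close>, and there are \<open>K \<le> L\<close> of these bounds.
\<close>

section \<open>Euclidean norms and singular values\<close>

lemma vec_norm2_eq_L2_set: "vec_norm2 v = L2_set (\<lambda>i. cmod (v $ i)) {..<dim_vec v}"
  by (simp add: vec_norm2_def L2_set_def)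

lemma vec_norm2_nonneg: "vec_norm2 v \<ge> 0"
  by (simp add: vec_norm2_eq_L2_set)

lemma vec_norm2_diff_le:
  assumes "dim_vec u = dim_vec v"
  shows "vec_norm2 (u - v) \<le> vec_norm2 u + vec_norm2 v"
proof -
  have "vec_norm2 (u - v) \<le> L2_set (\<lambda>i. cmod (u $ i) + cmod (v $ i)) {..<dim_vec v}"
    unfolding vec_norm2_eq_L2_set using assms
    by (auto intro!: L2_set_mono norm_triangle_ineq4)
  also have "\<dots> \<le> vec_norm2 u + vec_norm2 v"
    unfolding vec_norm2_eq_L2_set using assms L2_set_triangle_ineq by auto
  finally show ?thesis .
qed

text \<open>The real supremum in \<open>spectral_norm\<close> dominates its set only if that set is
  bounded. Entries of a unit vector have modulus at most 1, so each entry of the image is at most an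
  absolute row sum of \<open>A\<close>.\<close>

lemma bdd_above_spectral_norm:
  "bdd_above {vec_norm2 (A *\<^sub>v v) | v. v \<in> carrier_vec (dim_col A) \<and> vec_norm2 v = 1}"
proof (rule bdd_aboveI, clarsimp)
  fix v :: "complex vec"
  assume v: "v \<in> carrier_vec (dim_col A)" "vec_norm2 v = 1"
  have entry: "cmod (v $ j) \<le> 1" if "j < dim_col A" for j
    using member_le_L2_set[of "{..<dim_vec v}" j "\<lambda>i. cmod (v $ i)"] v that
    by (auto simp: vec_norm2_eq_L2_set)
  have "cmod ((A *\<^sub>v v) $ i) \<le> (\<Sum>j<dim_col A. cmod (A $$ (i, j)))" if "i < dim_row A" for i
  proof -
    have "(A *\<^sub>v v) $ i = (\<Sum>j<dim_col A. A $$ (i, j) * v $ j)"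
      using that v by (simp add: scalar_prod_def lessThan_atLeast0)
    also have "cmod \<dots> \<le> (\<Sum>j<dim_col A. cmod (A $$ (i, j)) * 1)"
      by (rule sum_norm_le) (use entry in \<open>auto simp: norm_mult intro!: mult_left_le\<close>)
    finally show ?thesis by simp
  qed
  then show "vec_norm2 (A *\<^sub>v v)
      \<le> L2_set (\<lambda>i. \<Sum>j<dim_col A. cmod (A $$ (i, j))) {..<dim_row A}"
    unfolding vec_norm2_eq_L2_set by (auto intro!: L2_set_mono)
qed

lemma vec_norm2_mult_le_spectral_norm:
  assumes "v \<in> carrier_vec (dim_col A)" "vec_norm2 v = 1"
  shows "vec_norm2 (A *\<^sub>v v) \<le> spectral_norm A"
  unfolding spectral_norm_def
  by (rule cSup_upper[OF _ bdd_above_spectral_norm]) (use assms in auto)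

section \<open>Gram matrices and their eigenvectors\<close>

lemma of_real_vec_norm2_square:
  "complex_of_real ((vec_norm2 v)\<^sup>2) = (\<Sum>i<dim_vec v. cnj (v $ i) * v $ i)"
proof -
  have "(vec_norm2 v)\<^sup>2 = (\<Sum>i<dim_vec v. (cmod (v $ i))\<^sup>2)"
    by (simp add: vec_norm2_def sum_nonneg)
  then show ?thesis
    by (simp only: of_real_sum complex_norm_square mult.commute)
qed

lemma index_mat_adjoint_mult_vec:
  fixes A :: "complex mat"
  assumes "w \<in> carrier_vec (dim_row A)" "i < dim_col A"
  shows "(mat_adjoint A *\<^sub>v w) $ i = (\<Sum>r<dim_row A. cnj (A $$ (r, i)) * w $ r)"
  using assms by (simp add: mat_adjoint_def scalar_prod_def lessThan_atLeast0)

text \<open>The adjoint moves to the other side of the inner product; in coordinates this is an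
  exchange of the two summations.\<close>

lemma gram_quadratic_form:
  fixes A :: "complex mat"
  assumes v: "v \<in> carrier_vec (dim_col A)"
  shows "(\<Sum>i<dim_col A. cnj (v $ i) * ((mat_adjoint A * A) *\<^sub>v v) $ i)
    = complex_of_real ((vec_norm2 (A *\<^sub>v v))\<^sup>2)"
proof -
  define w where "w = A *\<^sub>v v"
  have w: "w \<in> carrier_vec (dim_row A)" by (simp add: w_def carrier_vecI)
  have adj: "mat_adjoint A \<in> carrier_mat (dim_col A) (dim_row A)"
    by (auto simp: mat_adjoint_def)
  have "(mat_adjoint A * A) *\<^sub>v v = mat_adjoint A *\<^sub>v w"
    unfolding w_def by (rule assoc_mult_mat_vec[OF adj _ v]) simp
  then have "(\<Sum>i<dim_col A. cnj (v $ i) * ((mat_adjoint A * A) *\<^sub>v v) $ i)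
      = (\<Sum>i<dim_col A. \<Sum>r<dim_row A. cnj (v $ i) * (cnj (A $$ (r, i)) * w $ r))"
    by (simp add: index_mat_adjoint_mult_vec[OF w] sum_distrib_left)
  also have "\<dots> = (\<Sum>r<dim_row A. \<Sum>i<dim_col A. cnj (v $ i) * (cnj (A $$ (r, i)) * w $ r))"
    by (rule sum.swap)
  also have "\<dots> = (\<Sum>r<dim_row A. cnj (\<Sum>i<dim_col A. A $$ (r, i) * v $ i) * w $ r)"
    by (simp add: sum_distrib_right sum_distrib_left algebra_simps)
  also have "\<dots> = (\<Sum>r<dim_row A. cnj (w $ r) * w $ r)"
    using v by (intro sum.cong) (auto simp: w_def scalar_prod_def lessThan_atLeast0)
  finally show ?thesis
    using w of_real_vec_norm2_square[of w] by (simp flip: w_def)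
qed

text \<open>On an eigenvector the quadratic form of the Gram matrix is \<open>x\<close> times the
  squared norm. Since that norm is positive, \<open>x\<close> must be real and non-negative.\<close>

lemma gram_eigenvector:
  fixes A :: "complex mat"
  assumes "eigenvector (mat_adjoint A * A) v x"
  shows "x * complex_of_real ((vec_norm2 v)\<^sup>2) = complex_of_real ((vec_norm2 (A *\<^sub>v v))\<^sup>2)"
    and "v \<in> carrier_vec (dim_col A)" and "vec_norm2 v > 0"
proof -
  have dim: "dim_row (mat_adjoint A * A) = dim_col A"
    by (simp add: mat_adjoint_def)
  show v: "v \<in> carrier_vec (dim_col A)"
    using assms dim by (simp add: eigenvector_def)
  have ev: "(mat_adjoint A * A) *\<^sub>v v = x \<cdot>\<^sub>v v" and nz: "v \<noteq> 0\<^sub>v (dim_col A)"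
    using assms dim by (auto simp: eigenvector_def)
  show "x * complex_of_real ((vec_norm2 v)\<^sup>2) = complex_of_real ((vec_norm2 (A *\<^sub>v v))\<^sup>2)"
    using gram_quadratic_form[OF v] v
    by (simp add: ev of_real_vec_norm2_square[of v] sum_distrib_left mult.left_commute
        del: of_real_power)
  obtain i where "i < dim_col A" "v $ i \<noteq> 0"
    using nz v by (metis carrier_vecD eq_vecI index_zero_vec)
  then have "0 < cmod (v $ i)" "cmod (v $ i) \<le> vec_norm2 v"
    using member_le_L2_set[of "{..<dim_vec v}" i "\<lambda>i. cmod (v $ i)"] v
    by (auto simp: vec_norm2_eq_L2_set)
  then show "vec_norm2 v > 0" by linarith
qed

text \<open>As \<open>sqrt\<close> is an odd function on the reals, the sign of \<open>s\<close> is
  that of \<open>Re x\<close>, which the quadratic form determines.\<close>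

lemma singular_values_nonneg:
  assumes "s \<in># singular_values A"
  shows "s \<ge> 0"
proof -
  let ?B = "mat_adjoint A * A"
  have B: "?B \<in> carrier_mat (dim_col A) (dim_col A)"
    by (auto simp: mat_adjoint_def)
  \<comment> \<open>Only for a non-zero polynomial are the members of \<open>proots\<close> exactly
    the roots.\<close>
  have "char_poly ?B \<noteq> 0"
    using degree_monic_char_poly[OF B] by auto
  then obtain x where x: "s = sqrt (Re x)" "poly (char_poly ?B) x = 0"
    using assms by (auto simp: singular_values_def)
  then obtain v where v: "eigenvector ?B v x"
    using eigenvalue_root_char_poly[OF B] by (auto simp: eigenvalue_def)
  from gram_eigenvector(1)[OF v] have "Re x * (vec_norm2 v)\<^sup>2 = (vec_norm2 (A *\<^sub>v v))\<^sup>2"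
    by (simp add: complex_eq_iff del: of_real_power)
  then have "Re x \<ge> 0"
    using gram_eigenvector(3)[OF v]
    by (metis zero_le_mult_iff zero_le_power2 zero_less_power not_less)
  then show ?thesis using x by simp
qed

text \<open>The quadratic form gives the equality of squares; \<open>s \<ge> 0\<close> allows the
  roots to be taken.\<close>

lemma right_singular_vector_norm:
  assumes "right_singular_vector A s v"
  shows "vec_norm2 (A *\<^sub>v v) = s * vec_norm2 v" and "v \<in> carrier_vec (dim_col A)"
proof -
  have ev: "eigenvector (mat_adjoint A * A) v (complex_of_real (s\<^sup>2))" and "s \<ge> 0"
    using assms singular_values_nonneg by (auto simp: right_singular_vector_def)
  have "complex_of_real ((s * vec_norm2 v)\<^sup>2) = complex_of_real ((vec_norm2 (A *\<^sub>v v))\<^sup>2)"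
    using gram_eigenvector(1)[OF ev] by (simp add: power_mult_distrib)
  then have "(s * vec_norm2 v)\<^sup>2 = (vec_norm2 (A *\<^sub>v v))\<^sup>2"
    by (simp only: of_real_eq_iff)
  then show "vec_norm2 (A *\<^sub>v v) = s * vec_norm2 v"
    using \<open>s \<ge> 0\<close> vec_norm2_nonneg by (simp add: power2_eq_iff_nonneg)
  show "v \<in> carrier_vec (dim_col A)"
    by (rule gram_eigenvector(2)[OF ev])
qed

section \<open>Exponential sums and Lagrange interpolation\<close>

text \<open>Multiplication by \<open>z - b\<close> combines a shift of the coefficients with a
  multiple by \<open>b\<close>. The shift can only push coefficients out of the truncated sum, so
  the estimate holds for every cutoff \<open>n\<close>.\<close>

lemma sum_norm_coeff_linear_mult_le:
  fixes q :: "complex poly"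
  shows "(\<Sum>l<n. cmod (coeff ([:- b, 1:] * q) l)) \<le> (1 + cmod b) * (\<Sum>l<n. cmod (coeff q l))"
proof -
  have "(\<Sum>l<n. cmod (coeff ([:- b, 1:] * q) l))
      \<le> (\<Sum>l<n. cmod b * cmod (coeff q l) + cmod (coeff (pCons 0 q) l))"
  proof (rule sum_mono)
    fix l
    have "coeff ([:- b, 1:] * q) l = coeff (pCons 0 q) l - b * coeff q l"
      by simp
    then show "cmod (coeff ([:- b, 1:] * q) l)
        \<le> cmod b * cmod (coeff q l) + cmod (coeff (pCons 0 q) l)"
      by (metis norm_triangle_ineq4 norm_mult add.commute)
  qed
  also have "\<dots> = cmod b * (\<Sum>l<n. cmod (coeff q l)) + (\<Sum>l<n. cmod (coeff (pCons 0 q) l))"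
    by (simp add: sum.distrib sum_distrib_left)
  also have "(\<Sum>l<n. cmod (coeff (pCons 0 q) l)) \<le> (\<Sum>l<n. cmod (coeff q l))"
  proof (cases n)
    case (Suc m)
    have "(\<Sum>l<Suc m. cmod (coeff (pCons 0 q) l)) = (\<Sum>l<m. cmod (coeff q l))"
      by (simp only: sum.lessThan_Suc_shift) simp
    then show ?thesis using Suc by simp
  qed simp
  finally show ?thesis by (simp add: algebra_simps)
qed

lemma sum_norm_coeff_prod_linear_le:
  fixes \<beta> :: "'a \<Rightarrow> complex"
  assumes "finite S"
  shows "(\<Sum>l<n. cmod (coeff (\<Prod>k\<in>S. [:- \<beta> k, 1:]) l)) \<le> (\<Prod>k\<in>S. 1 + cmod (\<beta> k))"
  using assms
proof induction
  case empty
  have "(\<Sum>l<n. cmod (coeff (1 :: complex poly) l)) = (\<Sum>l<n. if l = 0 then 1 else 0)"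
    by (rule sum.cong) (auto simp: coeff_eq_0)
  then show ?case by simp
next
  case (insert a S)
  have "(\<Sum>l<n. cmod (coeff (\<Prod>k\<in>insert a S. [:- \<beta> k, 1:]) l))
      \<le> (1 + cmod (\<beta> a)) * (\<Sum>l<n. cmod (coeff (\<Prod>k\<in>S. [:- \<beta> k, 1:]) l))"
    using insert.hyps sum_norm_coeff_linear_mult_le by simp
  also have "\<dots> \<le> (1 + cmod (\<beta> a)) * (\<Prod>k\<in>S. 1 + cmod (\<beta> k))"
    by (rule mult_left_mono[OF insert.IH]) simp
  finally show ?case using insert.hyps by simp
qed

section \<open>Separation of the bases and recovery of coefficients\<close>

lemma sigma_bases_le:
  assumes "i < K" "j < K" "i \<noteq> j"
  shows "sigma_bases K \<beta> \<le> cmod (\<beta> i - \<beta> j)"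
proof -
  let ?S = "{cmod (\<beta> l - \<beta> k) | l k. l < k \<and> k < K}"
  have "finite ?S"
    by (rule finite_subset[of _ "(\<lambda>(l, k). cmod (\<beta> l - \<beta> k)) ` ({..<K} \<times> {..<K})"]) auto
  moreover have "cmod (\<beta> i - \<beta> j) \<in> ?S"
  proof (cases "i < j")
    case True
    then show ?thesis using assms by blast
  next
    case False
    then have "j < i" using assms by simp
    then show ?thesis using assms norm_minus_commute by blast
  qed
  ultimately show ?thesis unfolding sigma_bases_def by (rule Min_le)
qed

text \<open>With two indices available the set of distances is non-empty, so its minimum is attained
  at a pair of distinct bases.\<close>

lemma sigma_bases_pos:
  assumes "inj_on \<beta> {..<K}" "K \<ge> 2"
  shows "sigma_bases K \<beta> > 0"
proof -
  let ?S = "{cmod (\<beta> l - \<beta> k) | l k. l < k \<and> k < K}"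
  have "finite ?S"
    by (rule finite_subset[of _ "(\<lambda>(l, k). cmod (\<beta> l - \<beta> k)) ` ({..<K} \<times> {..<K})"]) auto
  moreover have "cmod (\<beta> 0 - \<beta> 1) \<in> ?S"
    using assms by force
  ultimately have "sigma_bases K \<beta> \<in> ?S"
    unfolding sigma_bases_def by (intro Min_in) auto
  then show ?thesis
    using inj_onD[OF assms(1)] by force
qed

text \<open>This bounds the rows of an inverse Vandermonde matrix: the coefficients of
  \<open>q\<close> divided by \<open>poly q (\<beta> j)\<close> are those of the Lagrange basis
  polynomial at node \<open>j\<close>.\<close>

lemma norm_coefficient_exponential_sum_le:
  fixes c \<beta> y :: "nat \<Rightarrow> complex"
  assumes y: "\<And>l. l < K \<Longrightarrow> y l = (\<Sum>i<K. c i * \<beta> i ^ l)"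
    and inj: "inj_on \<beta> {..<K}" and j: "j < K"
  shows "cmod (c j) \<le> pi_bases K \<beta> / sigma_bases K \<beta> ^ (K - 1) * L2_set (\<lambda>l. cmod (y l)) {..<K}"
proof -
  define S where "S = {..<K} - {j}"
  define q where "q = (\<Prod>k\<in>S. [:- \<beta> k, 1:])"
  have S: "finite S" "card S = K - 1"
    using j by (auto simp: S_def)
  have poly_q: "poly q z = (\<Prod>k\<in>S. z - \<beta> k)" for z
    by (simp add: q_def poly_prod)
  \<comment> \<open>A degree below \<open>K\<close> ensures that the first \<open>K\<close> samples
    involve every coefficient of \<open>q\<close>.\<close>
  have "degree q \<le> (\<Sum>k\<in>S. degree [:- \<beta> k, 1:])"
    unfolding q_def by (rule degree_prod_sum_le[OF S(1), unfolded o_def])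
  then have deg: "degree q < K"
    using S j by simp
  have "(\<Sum>l<K. coeff q l * y l) = (\<Sum>l<K. \<Sum>i<K. c i * (coeff q l * \<beta> i ^ l))"
    by (auto simp: y sum_distrib_left algebra_simps intro!: sum.cong)
  also have "\<dots> = (\<Sum>i<K. c i * (\<Sum>l<K. coeff q l * \<beta> i ^ l))"
    by (subst sum.swap) (simp add: sum_distrib_left)
  also have "\<dots> = (\<Sum>i<K. c i * poly q (\<beta> i))"
  proof -
    have "(\<Sum>l<K. coeff q l * z ^ l) = poly q z" for z
      unfolding poly_altdef using deg
      by (intro sum.mono_neutral_right) (auto simp: coeff_eq_0)
    then show ?thesis by simp
  qed
  \<comment> \<open>All nodes other than \<open>\<beta> j\<close> are zeros of
    \<open>q\<close>.\<close>
  also have "\<dots> = (\<Sum>i<K. if i = j then c j * poly q (\<beta> j) else 0)"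
    by (rule sum.cong) (auto simp: poly_q S_def)
  also have "\<dots> = c j * poly q (\<beta> j)"
    using j by simp
  finally have pairing: "c j * poly q (\<beta> j) = (\<Sum>l<K. coeff q l * y l)" ..

  \<comment> \<open>The outer absolute values give the form in which Cauchy-Schwarz is
    stated.\<close>
  have "cmod (\<Sum>l<K. coeff q l * y l) \<le> (\<Sum>l<K. \<bar>cmod (coeff q l)\<bar> * \<bar>cmod (y l)\<bar>)"
    by (rule sum_norm_le) (simp add: norm_mult)
  also have "\<dots> \<le> L2_set (\<lambda>l. cmod (coeff q l)) {..<K} * L2_set (\<lambda>l. cmod (y l)) {..<K}"
    by (rule L2_set_mult_ineq)
  also have "\<dots> \<le> pi_bases K \<beta> * L2_set (\<lambda>l. cmod (y l)) {..<K}"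
  proof (rule mult_right_mono)
    have "L2_set (\<lambda>l. cmod (coeff q l)) {..<K} \<le> (\<Sum>l<K. cmod (coeff q l))"
      by (rule L2_set_le_sum) simp
    also have "\<dots> \<le> (\<Prod>k\<in>S. 1 + cmod (\<beta> k))"
      unfolding q_def by (rule sum_norm_coeff_prod_linear_le[OF S(1)])
    \<comment> \<open>The missing factor \<open>1 + cmod (\<beta> j)\<close> is at least 1.\<close>
    also have "\<dots> \<le> pi_bases K \<beta>"
      unfolding pi_bases_def
      by (rule prod_mono2) (auto simp: S_def)
    finally show "L2_set (\<lambda>l. cmod (coeff q l)) {..<K} \<le> pi_bases K \<beta>" .
  qed simp
  finally have upper: "cmod (c j) * cmod (poly q (\<beta> j)) \<le> pi_bases K \<beta> * L2_set (\<lambda>l. cmod (y l)) {..<K}"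
    by (simp flip: pairing norm_mult)

  \<comment> \<open>For \<open>K = 1\<close> the exponent is 0, so the power is 1 whatever the
    minimum of the empty set is.\<close>
  have pos: "0 < sigma_bases K \<beta> ^ (K - 1)"
    using sigma_bases_pos[OF inj] j by (cases "K = 1") auto
  have "sigma_bases K \<beta> ^ (K - 1) = (\<Prod>k\<in>S. sigma_bases K \<beta>)"
    using S by simp
  also have "\<dots> \<le> (\<Prod>k\<in>S. cmod (\<beta> j - \<beta> k))"
  proof (rule prod_mono)
    fix k assume k: "k \<in> S"
    \<comment> \<open>Both \<open>j\<close> and the different index \<open>k\<close> lie below
      \<open>K\<close>, so \<open>sigma_bases\<close> is a genuine minimum here.\<close>
    then have "K \<ge> 2" using j by (auto simp: S_def)
    then show "0 \<le> sigma_bases K \<beta> \<and> sigma_bases K \<beta> \<le> cmod (\<beta> j - \<beta> k)"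
      using k j sigma_bases_pos[OF inj] sigma_bases_le[of j K k \<beta>]
      by (auto simp: S_def less_imp_le)
  qed
  also have "\<dots> = cmod (poly q (\<beta> j))"
    by (simp add: poly_q prod_norm)
  finally have "cmod (c j) * sigma_bases K \<beta> ^ (K - 1) \<le> cmod (c j) * cmod (poly q (\<beta> j))"
    by (rule mult_left_mono) simp
  also note upper
  finally show ?thesis
    using pos by (simp add: field_simps)
qed

section \<open>Perturbed Hankel matrices\<close>

lemma hankel_mat_mult_vec:
  assumes "v \<in> carrier_vec n" "i < m"
  shows "(hankel_mat m n f *\<^sub>v v) $ i = (\<Sum>k<n. f (i + k) * v $ k)"
  using assms by (simp add: hankel_mat_def scalar_prod_def lessThan_atLeast0)

theorem theorem9p4:
  fixes K L :: nat
    and h e \<eta> \<beta> :: "nat \<Rightarrow> complex"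
    and E H :: "complex mat"
    and \<gamma> :: "complex vec"
    and \<sigma> :: real
    and P :: "complex poly"
  assumes "K \<ge> 1" and "L > 2 * K"
    and "\<And>k. k < K \<Longrightarrow> \<eta> k \<noteq> 0"
    and "\<And>k. k < K \<Longrightarrow> \<beta> k \<noteq> 0"
    and "inj_on \<beta> {..<K}"
    and "\<And>l. l < L \<Longrightarrow> h l = (\<Sum>k<K. \<eta> k * \<beta> k ^ l)"
    and "E = hankel_mat (L - K) (K + 1) e"
    and "H = hankel_mat (L - K) (K + 1) (\<lambda>l. h l + e l)"
    and "\<sigma> = smallest_singular_value H"
    and "right_singular_vector H \<sigma> \<gamma>"
    and "vec_norm2 \<gamma> = 1"
    and "P = (\<Sum>k\<le>K. monom (\<gamma> $ k) k)"
  shows "(\<Sum>k<K. (cmod (\<eta> k))\<^sup>2 * (cmod (poly P (\<beta> k)))\<^sup>2)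
    \<le> real L * (pi_bases K \<beta> / sigma_bases K \<beta> ^ (K - 1))\<^sup>2 * (\<sigma> + spectral_norm E)\<^sup>2"
proof -
  note L = \<open>L > 2 * K\<close> and h = assms(6) and E = assms(7) and H = assms(8) and P = assms(12)
  define y where "y = H *\<^sub>v \<gamma> - E *\<^sub>v \<gamma>"
  define c where "c j = \<eta> j * poly P (\<beta> j)" for j
  have dims: "dim_row E = L - K" "dim_row H = L - K" "dim_col E = K + 1" "dim_col H = K + 1"
    by (simp_all add: E H hankel_mat_def)
  have \<gamma>: "\<gamma> \<in> carrier_vec (K + 1)"
    using right_singular_vector_norm(2)[OF assms(10)] dims by simp
  have dim_y: "dim_vec y = L - K"
    by (simp add: y_def dims)

  have norm_y: "vec_norm2 y \<le> \<sigma> + spectral_norm E"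
  proof -
    have "vec_norm2 y \<le> vec_norm2 (H *\<^sub>v \<gamma>) + vec_norm2 (E *\<^sub>v \<gamma>)"
      unfolding y_def by (rule vec_norm2_diff_le) (simp add: dims)
    also have "vec_norm2 (H *\<^sub>v \<gamma>) = \<sigma>"
      using right_singular_vector_norm(1)[OF assms(10)] assms(11) by simp
    also have "vec_norm2 (E *\<^sub>v \<gamma>) \<le> spectral_norm E"
      by (rule vec_norm2_mult_le_spectral_norm) (use \<gamma> dims assms(11) in auto)
    finally show ?thesis by simp
  qed

  have y: "y $ l = (\<Sum>j<K. c j * \<beta> j ^ l)" if "l < K" for l
  proof -
    \<comment> \<open>The assumption \<open>L > 2 * K\<close> leaves more than \<open>K\<close>
      rows, so \<open>y\<close> has all the samples that the interpolation needs.\<close>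
    have l: "l < L - K" using that L by simp
    have "y $ l = (\<Sum>k<K + 1. (h (l + k) + e (l + k)) * \<gamma> $ k) - (\<Sum>k<K + 1. e (l + k) * \<gamma> $ k)"
      unfolding y_def using l dims(1)
      by (simp only: index_minus_vec dim_mult_mat_vec E H hankel_mat_mult_vec[OF \<gamma> l])
    also have "\<dots> = (\<Sum>k<K + 1. h (l + k) * \<gamma> $ k)"
      unfolding sum_subtractf[symmetric] by (simp add: algebra_simps)
    also have "\<dots> = (\<Sum>k<K + 1. \<Sum>j<K. \<eta> j * \<beta> j ^ l * (\<gamma> $ k * \<beta> j ^ k))"
    proof (rule sum.cong)
      fix k assume "k \<in> {..<K + 1}"
      \<comment> \<open>The index \<open>l + k\<close> is at most \<open>2 * K - 1\<close>, hence in
        the range where \<open>h\<close> is an exponential sum.\<close>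
      then have "l + k < L" using that L by simp
      then show "h (l + k) * \<gamma> $ k = (\<Sum>j<K. \<eta> j * \<beta> j ^ l * (\<gamma> $ k * \<beta> j ^ k))"
        by (simp add: h sum_distrib_right sum_distrib_left power_add algebra_simps)
    qed simp
    \<comment> \<open>After the exchange the inner sum is \<open>poly P (\<beta> j)\<close>.\<close>
    also have "\<dots> = (\<Sum>j<K. \<eta> j * \<beta> j ^ l * (\<Sum>k<K + 1. \<gamma> $ k * \<beta> j ^ k))"
      by (subst sum.swap) (simp only: sum_distrib_left)
    also have "\<dots> = (\<Sum>j<K. c j * \<beta> j ^ l)"
      by (simp add: c_def P poly_sum poly_monom lessThan_Suc_atMost algebra_simps)
    finally show ?thesis .
  qed

  let ?C = "pi_bases K \<beta> / sigma_bases K \<beta> ^ (K - 1)"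
  have "0 \<le> pi_bases K \<beta>"
    by (simp add: pi_bases_def prod_nonneg)
  moreover have "0 < sigma_bases K \<beta> ^ (K - 1)"
    using sigma_bases_pos[OF assms(5)] assms(1) by (cases "K = 1") auto
  ultimately have C: "0 \<le> ?C"
    by simp
  have bound: "(cmod (c j))\<^sup>2 \<le> ?C\<^sup>2 * (\<sigma> + spectral_norm E)\<^sup>2" if "j < K" for j
  proof -
    \<comment> \<open>Passing from the first \<open>K\<close> entries to all \<open>L - K\<close>
      entries only adds non-negative squares.\<close>
    have "L2_set (\<lambda>l. cmod (y $ l)) {..<K} \<le> vec_norm2 y"
      unfolding vec_norm2_def L2_set_def
      using L dim_y by (intro real_sqrt_le_mono sum_mono2) auto
    also note norm_y
    finally have "?C * L2_set (\<lambda>l. cmod (y $ l)) {..<K} \<le> ?C * (\<sigma> + spectral_norm E)"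
      by (rule mult_left_mono[OF _ C])
    then have "cmod (c j) \<le> ?C * (\<sigma> + spectral_norm E)"
      using norm_coefficient_exponential_sum_le[where y = "\<lambda>l. y $ l", OF y assms(5) that]
      by linarith
    then show ?thesis
      unfolding power_mult_distrib[symmetric] by (intro power_mono) auto
  qed
  have "(\<Sum>k<K. (cmod (\<eta> k))\<^sup>2 * (cmod (poly P (\<beta> k)))\<^sup>2) = (\<Sum>j<K. (cmod (c j))\<^sup>2)"
    by (simp add: c_def norm_mult power_mult_distrib)
  also have "\<dots> \<le> real K * (?C\<^sup>2 * (\<sigma> + spectral_norm E)\<^sup>2)"
    using sum_bounded_above[of "{..<K}" "\<lambda>j. (cmod (c j))\<^sup>2"] bound by simp
  also have "\<dots> \<le> real L * (?C\<^sup>2 * (\<sigma> + spectral_norm E)\<^sup>2)"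
    using L by (intro mult_right_mono) auto
  finally show ?thesis
    by (simp add: mult.assoc)
qed

end
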